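(* Let $\mathcal{G}$ be a finite simple graph with $p=|V(\mathcal{G})|$ vertices, $|e(\mathcal{G})|$ edges, first Zagreb index $M_1(\mathcal{G})$, maximum degree $\Delta$ and minimum degree $\delta$. Then \[ LE_{CN}(\mathcal{G})\ge 2\left(\Delta(\delta-1)-\frac{M_1(\mathcal{G})-2|e(\mathcal{G})|}{p}\right)\quad\text{and}\quad LE^+_{CN}(\mathcal{G})\ge 2\left(\Delta(\delta-1)-\frac{M_1(\mathcal{G})-2|e(\mathcal{G})|}{p}\right). \]
   Context: For $\mathcal{G}$ on vertices $v_1,\dots,v_p$: $M_1(\mathcal{G})=\sum_i d(v_i)^2$; $\mathrm{CN}(\mathcal{G})$ has $(i,j)$-entry $|N(v_i)\cap N(v_j)|$ for $i\neq j$ (open neighbourhoods) and $0$ on the diagonal; $\mathrm{CNRS}(\mathcal{G})$ is the diagonal matrix of its row sums; $\mathrm{CNL}=\mathrm{CNRS}-\mathrm{CN}$, $\mathrm{CNSL}=\mathrm{CNRS}+\mathrm{CN}$; $LE_{CN}(\mathcal{G})=\sum_\nu|\nu-tr(\mathrm{CNRS}(\mathcal{G}))/p|$ over eigenvalues of $\mathrm{CNL}(\mathcal{G})$ with multiplicity, and $LE^+_{CN}(\mathcal{G})$ likewise with $\mathrm{CNSL}(\mathcal{G})$. *)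

theory Defs
  imports Complex_Main "Jordan_Normal_Form.Char_Poly"
begin

locale simple_graph =
  fixes V :: "'a set" and E :: "'a set set"
  assumes finite_vertices: "finite V"
    and edges: "\<And>e. e \<in> E \<Longrightarrow> e \<subseteq> V \<and> card e = 2"

definition nbhd :: "'a set set \<Rightarrow> 'a \<Rightarrow> 'a set" where
  "nbhd E v = {u. {u, v} \<in> E}"

definition vdegree :: "'a set set \<Rightarrow> 'a \<Rightarrow> nat" where
  "vdegree E v = card (nbhd E v)"

definition zagreb1 :: "'a set \<Rightarrow> 'a set set \<Rightarrow> nat" where
  "zagreb1 V E = (\<Sum>v\<in>V. (vdegree E v)\<^sup>2)"

definition max_degree :: "'a set \<Rightarrow> 'a set set \<Rightarrow> nat" where
  "max_degree V E = Max (vdegree E ` V)"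

definition min_degree :: "'a set \<Rightarrow> 'a set set \<Rightarrow> nat" where
  "min_degree V E = Min (vdegree E ` V)"

text \<open>
  The matrices below depend on an enumeration of the vertices, given as a list \<open>vs\<close>
  (distinct, with \<open>set vs = V\<close>); the index \<open>i < length vs\<close> stands for the vertex
  \<open>vs ! i\<close>, so indices start at 0.
\<close>

definition CN :: "'a set set \<Rightarrow> 'a list \<Rightarrow> real mat" where
  "CN E vs = mat (length vs) (length vs) (\<lambda>(i, j).
     if i = j then 0 else real (card (nbhd E (vs ! i) \<inter> nbhd E (vs ! j))))"

definition CNRS :: "'a set set \<Rightarrow> 'a list \<Rightarrow> real mat" where
  "CNRS E vs = mat (length vs) (length vs) (\<lambda>(i, j).
     if i = j then (\<Sum>k<length vs. CN E vs $$ (i, k)) else 0)"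

definition CNL :: "'a set set \<Rightarrow> 'a list \<Rightarrow> real mat" where
  "CNL E vs = CNRS E vs - CN E vs"

definition CNSL :: "'a set set \<Rightarrow> 'a list \<Rightarrow> real mat" where
  "CNSL E vs = CNRS E vs + CN E vs"

definition mat_trace :: "'a :: comm_monoid_add mat \<Rightarrow> 'a" where
  "mat_trace A = sum_list (diag_mat A)"

text \<open>
  Eigenvalues are counted with algebraic multiplicity and taken over the complex numbers, so
  that an \<open>n\<close> by \<open>n\<close> matrix has exactly \<open>n\<close> of them; for the symmetric
  matrices considered here they are all real.
\<close>

definition eigenvalues_mset :: "real mat \<Rightarrow> complex multiset" where
  "eigenvalues_mset A = proots (char_poly (map_mat complex_of_real A))"

definition LE_CN :: "'a set set \<Rightarrow> 'a list \<Rightarrow> real" where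
  "LE_CN E vs = (\<Sum>\<nu>\<in>#eigenvalues_mset (CNL E vs).
     cmod (\<nu> - complex_of_real (mat_trace (CNRS E vs) / real (length vs))))"

definition LE_CN_plus :: "'a set set \<Rightarrow> 'a list \<Rightarrow> real" where
  "LE_CN_plus E vs = (\<Sum>\<nu>\<in>#eigenvalues_mset (CNSL E vs).
     cmod (\<nu> - complex_of_real (mat_trace (CNRS E vs) / real (length vs))))"

end

theory Submission
  imports Defs "Jordan_Normal_Form.Schur_Decomposition" "Jordan_Normal_Form.Spectral_Radius"
begin

text \<open>
  Let \<open>A\<close> be a real symmetric matrix and \<open>m\<close> the mean of its eigenvalues. The
  deviations \<open>\<nu> - m\<close> sum to zero, so the sum of their moduli is at least twice any
  one of them, and it suffices to find an eigenvalue with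
  \<open>\<bar>\<nu> - m\<bar> \<ge> \<bar>A i i - m\<bar>\<close>. It exists because, for symmetric
  \<open>B\<close>, the entry \<open>(B * B) i i\<close> is a sum of squares and hence at least
  \<open>(B i i)\<^sup>2\<close>: repeated squaring shows that the powers of \<open>B\<close> are unbounded
  once \<open>\<bar>B i i\<bar> > 1\<close>, so the spectral radius of \<open>B\<close> is at least 1; apply
  this to multiples of \<open>A - m\<close>. No diagonalisation of \<open>A\<close> is needed.

  For the graph matrices the diagonal entry at \<open>v\<close> is the sum of \<open>d(u) - 1\<close> over
  the neighbours \<open>u\<close> of \<open>v\<close>, which is at least \<open>\<Delta> (\<delta> - 1)\<close> if
  \<open>v\<close> has maximum degree.
\<close>

section \<open>Trace and spectrum\<close>

lemma mat_trace_eq_sum: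
  assumes "A \<in> carrier_mat n n"
  shows "mat_trace A = (\<Sum>i<n. A $$ (i, i))"
  using assms by (simp add: mat_trace_def diag_mat_def sum_list_sum_nth atLeast0LessThan)

lemma mat_trace_mult_commute:
  fixes A B :: "'a :: comm_semiring_0 mat"
  assumes "A \<in> carrier_mat n n" and "B \<in> carrier_mat n n"
  shows "mat_trace (A * B) = mat_trace (B * A)"
proof -
  have "mat_trace (A * B) = (\<Sum>i<n. \<Sum>j<n. A $$ (i, j) * B $$ (j, i))"
    using assms by (simp add: mat_trace_eq_sum[of _ n] scalar_prod_def atLeast0LessThan)
  also have "\<dots> = (\<Sum>j<n. \<Sum>i<n. B $$ (j, i) * A $$ (i, j))"
    by (subst sum.swap) (simp add: mult.commute)
  also have "\<dots> = mat_trace (B * A)"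
    using assms by (simp add: mat_trace_eq_sum[of _ n] scalar_prod_def atLeast0LessThan)
  finally show ?thesis .
qed

text \<open>With \<open>A = P * B * Q\<close>, cyclicity brings \<open>Q\<close> next to
  \<open>P\<close>, where they cancel.\<close>

lemma mat_trace_similar:
  fixes A B :: "'a :: comm_ring_1 mat"
  assumes "similar_mat_wit A B P Q"
  shows "mat_trace A = mat_trace B"
proof -
  note w = similar_mat_witD[OF refl assms]
  have "mat_trace A = mat_trace (Q * (P * B))"
    using w by (metis mat_trace_mult_commute mult_carrier_mat)
  also have "Q * (P * B) = Q * P * B"
    using w by (metis assoc_mult_mat)
  finally show ?thesis
    using w(2,5) by simp
qed

lemma proots_linear_factors: "proots (\<Prod>a\<leftarrow>as. [:- a, 1:]) = mset as"
  for as :: "'a :: idom list"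
proof (induction as)
  case (Cons a as)
  have "(\<Prod>a\<leftarrow>as. [:- a, 1:]) \<noteq> 0"
    by (auto)
  then have "proots ([:- a, 1:] * (\<Prod>a\<leftarrow>as. [:- a, 1:])) = add_mset a (mset as)"
    by (subst proots_mult) (simp_all add: Cons)
  then show ?case
    by (simp del: mult_pCons_left)
qed simp

text \<open>Over the complex numbers the characteristic polynomial splits, and Schur
  triangularisation places its roots on the diagonal of a similar matrix; similarity preserves the
  trace.\<close>

lemma proots_char_poly_complex:
  fixes A :: "complex mat"
  assumes A: "A \<in> carrier_mat n n"
  shows "size (proots (char_poly A)) = n"
    and "sum_mset (proots (char_poly A)) = mat_trace A"
    and "set_mset (proots (char_poly A)) = spectrum A"
proof -
  obtain as where as: "char_poly A = (\<Prod>a\<leftarrow>as. [:- a, 1:])" "length as = n"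
    using char_poly_factorized[OF A] by blast
  obtain B P Q where d: "schur_decomposition A as = (B, P, Q)"
    by (cases "schur_decomposition A as")
  note sd = schur_decomposition[OF A as(1) d]
  have "mat_trace A = mat_trace B"
    using sd mat_trace_similar by blast
  also have "\<dots> = sum_list as"
    using sd by (simp add: mat_trace_def)
  finally show "sum_mset (proots (char_poly A)) = mat_trace A"
    by (simp add: as proots_linear_factors sum_mset_sum_list)
  show "size (proots (char_poly A)) = n"
    by (simp add: as proots_linear_factors)
  have "char_poly A \<noteq> 0"
    using degree_monic_char_poly[OF A] by auto
  then show "set_mset (proots (char_poly A)) = spectrum A"
    by (simp add: spectrum_root_char_poly[OF A])
qed

text \<open>The same eigenvector serves both matrices. This carries an eigenvalue of a shifted and
  rescaled matrix back to the original one.\<close>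

lemma eigenvalue_affine:
  fixes A :: "'a :: field mat"
  assumes A: "A \<in> carrier_mat n n" and "c \<noteq> 0"
    and ev: "eigenvalue (c \<cdot>\<^sub>m (A - b \<cdot>\<^sub>m 1\<^sub>m n)) \<mu>"
  shows "eigenvalue A (\<mu> / c + b)"
proof -
  obtain v where v: "v \<in> carrier_vec n" "v \<noteq> 0\<^sub>v n"
    and eq: "(c \<cdot>\<^sub>m (A - b \<cdot>\<^sub>m 1\<^sub>m n)) *\<^sub>v v = \<mu> \<cdot>\<^sub>v v"
    using ev A unfolding eigenvalue_def eigenvector_def by auto
  have "(b \<cdot>\<^sub>m 1\<^sub>m n) *\<^sub>v v = b \<cdot>\<^sub>v v"
    using v by (intro eq_vecI) auto
  then have "(A - b \<cdot>\<^sub>m 1\<^sub>m n) *\<^sub>v v = A *\<^sub>v v - b \<cdot>\<^sub>v v"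
    using A v by (simp add: minus_mult_distrib_mat_vec[of _ n n])
  moreover have "(c \<cdot>\<^sub>m (A - b \<cdot>\<^sub>m 1\<^sub>m n)) *\<^sub>v v = c \<cdot>\<^sub>v ((A - b \<cdot>\<^sub>m 1\<^sub>m n) *\<^sub>v v)"
    using A v by (intro eq_vecI) auto
  ultimately have "(c \<cdot>\<^sub>m (A - b \<cdot>\<^sub>m 1\<^sub>m n)) *\<^sub>v v = c \<cdot>\<^sub>v (A *\<^sub>v v - b \<cdot>\<^sub>v v)"
    by simp
  then have "c * ((A *\<^sub>v v) $ i - b * v $ i) = \<mu> * v $ i" if "i < n" for i
    using arg_cong[OF eq, of "\<lambda>w. w $ i"] A v that by simp
  then have "(A *\<^sub>v v) $ i = (\<mu> / c + b) * v $ i" if "i < n" for i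
    using that \<open>c \<noteq> 0\<close> by (simp add: field_simps)
  then have "A *\<^sub>v v = (\<mu> / c + b) \<cdot>\<^sub>v v"
    using A v by (intro eq_vecI) auto
  then show ?thesis
    using A v unfolding eigenvalue_def eigenvector_def by auto
qed

section \<open>Symmetric matrices\<close>

lemma transpose_pow_mat:
  fixes A :: "'a :: comm_semiring_1 mat"
  assumes A: "A \<in> carrier_mat n n" and sym: "A\<^sup>T = A"
  shows "(A ^\<^sub>m k)\<^sup>T = A ^\<^sub>m k"
proof (induction k)
  case (Suc k)
  \<comment> \<open>Powers grow by a factor on the right, which transposition moves to the
    left.\<close>
  have "A * A ^\<^sub>m k = A ^\<^sub>m k * A"
    by (induction k) (use A in \<open>auto simp: assoc_mult_mat[of _ n n _ n _ n, symmetric]\<close>)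
  then show ?case
    using A sym Suc by (simp add: transpose_mult[of _ n n _ n])
qed (use A in simp)

lemma pow_mat_add:
  fixes A :: "'a :: semiring_1 mat"
  assumes A: "A \<in> carrier_mat n n"
  shows "A ^\<^sub>m (k + l) = A ^\<^sub>m k * A ^\<^sub>m l"
  by (induction l) (use A in \<open>auto simp: assoc_mult_mat[of _ n n _ n _ n]\<close>)

text \<open>Exponents are powers of two so that each induction step squares a matrix that is again
  symmetric.\<close>

lemma symmetric_pow_diag_ge:
  fixes A :: "real mat"
  assumes A: "A \<in> carrier_mat n n" and sym: "A\<^sup>T = A" and i: "i < n"
  shows "\<bar>A $$ (i, i)\<bar> ^ 2 ^ k \<le> \<bar>(A ^\<^sub>m 2 ^ k) $$ (i, i)\<bar>"
proof (induction k)
  case (Suc k)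
  define B where "B = A ^\<^sub>m 2 ^ k"
  have B: "B \<in> carrier_mat n n" and symB: "B\<^sup>T = B"
    using A sym by (auto simp: B_def transpose_pow_mat)
  have "A ^\<^sub>m 2 ^ Suc k = B * B"
    using A by (simp add: B_def mult_2 pow_mat_add[of A n])
  then have "(A ^\<^sub>m 2 ^ Suc k) $$ (i, i) = (\<Sum>j<n. B $$ (i, j) * B $$ (j, i))"
    using B i by (simp add: scalar_prod_def atLeast0LessThan)
  also have "\<dots> = (\<Sum>j<n. (B $$ (i, j))\<^sup>2)"
  proof (rule sum.cong[OF refl])
    fix j assume "j \<in> {..<n}"
    then have "B $$ (j, i) = B $$ (i, j)"
      using B i symB index_transpose_mat(1)[of i B j] by auto
    then show "B $$ (i, j) * B $$ (j, i) = (B $$ (i, j))\<^sup>2"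
      by (simp add: power2_eq_square)
  qed
  finally have eq: "(A ^\<^sub>m 2 ^ Suc k) $$ (i, i) = (\<Sum>j<n. (B $$ (i, j))\<^sup>2)" .
  have "\<bar>A $$ (i, i)\<bar> ^ 2 ^ Suc k = (\<bar>A $$ (i, i)\<bar> ^ 2 ^ k)\<^sup>2"
    by (simp add: power_mult[symmetric] mult.commute)
  also have "\<dots> \<le> \<bar>B $$ (i, i)\<bar>\<^sup>2"
    using Suc by (intro power_mono) (auto simp: B_def)
  also have "\<dots> \<le> (\<Sum>j<n. (B $$ (i, j))\<^sup>2)"
    using i by (simp add: member_le_sum[of i "{..<n}" "\<lambda>j. (B $$ (i, j))\<^sup>2"])
  finally show ?case
    by (simp only: eq abs_of_nonneg[OF sum_nonneg[OF zero_le_power2]])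
qed (use A in simp)

lemma symmetric_spectral_radius_ge_1:
  fixes A :: "real mat"
  assumes A: "A \<in> carrier_mat n n" and sym: "A\<^sup>T = A" and i: "i < n"
    and gt: "\<bar>A $$ (i, i)\<bar> > 1"
  shows "spectral_radius (map_mat complex_of_real A) \<ge> 1"
proof (rule ccontr)
  let ?C = "map_mat complex_of_real A"
  assume "\<not> ?thesis"
  then obtain c where c: "norm_bound (?C ^\<^sub>m k) c" for k
    using spectral_radius_jnf_norm_bound_less_1_upper_triangular[of ?C n] A by auto
  obtain k where k: "c < \<bar>A $$ (i, i)\<bar> ^ k"
    using gt real_arch_pow by blast
  \<comment> \<open>The growth estimate covers only exponents \<open>2 ^ k\<close>; since
    \<open>k \<le> 2 ^ k\<close> and the base exceeds 1, the bound \<open>c\<close> is still passed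
    there.\<close>
  also have "\<dots> \<le> \<bar>A $$ (i, i)\<bar> ^ 2 ^ k"
    using gt by (intro power_increasing) (auto intro: less_imp_le)
  also have "\<dots> \<le> \<bar>(A ^\<^sub>m 2 ^ k) $$ (i, i)\<bar>"
    by (rule symmetric_pow_diag_ge[OF A sym i])
  also have "\<dots> = norm ((?C ^\<^sub>m 2 ^ k) $$ (i, i))"
    using A i by (simp add: of_real_hom.mat_hom_pow[OF A, symmetric])
  also have "\<dots> \<le> c"
    using c[of "2 ^ k"] A i by (auto simp: norm_bound_def)
  finally show False by simp
qed

lemma symmetric_eigenvalue_dist_ge:
  fixes A :: "real mat"
  assumes A: "A \<in> carrier_mat n n" and sym: "A\<^sup>T = A" and i: "i < n"
  shows "\<exists>\<nu>\<in>spectrum (map_mat complex_of_real A).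
    \<bar>A $$ (i, i) - m\<bar> \<le> cmod (\<nu> - complex_of_real m)"
proof (rule ccontr)
  let ?C = "map_mat complex_of_real A"
  let ?D = "(\<lambda>\<nu>. cmod (\<nu> - complex_of_real m)) ` spectrum ?C"
  define t where "t = \<bar>A $$ (i, i) - m\<bar>"
  define r where "r = Max ?D"
  assume "\<not> ?thesis"
  then have lt: "x < t" if "x \<in> ?D" for x
    using that by (force simp: t_def)
  have C: "?C \<in> carrier_mat n n" using A by simp
  have D: "finite ?D" "?D \<noteq> {}"
    using card_finite_spectrum[OF C] spectrum_non_empty[OF C] i by auto
  have r: "x \<le> r" if "x \<in> ?D" for x
    using D that by (simp add: r_def)
  \<comment> \<open>The spectrum is finite, so the largest distance \<open>r\<close> is attained and
    lies strictly below \<open>t\<close>.\<close>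
  have "r \<in> ?D"
    using Max_in[OF D] by (simp only: r_def)
  then have "r < t" "0 \<le> r"
    using lt by auto
  \<comment> \<open>Dividing by an \<open>s\<close> strictly between \<open>r\<close> and
    \<open>t\<close> puts the diagonal entry of \<open>B\<close> above 1 in modulus, while every
    eigenvalue of \<open>B\<close> should stay below 1.\<close>
  then obtain s where s: "r < s" "s < t" "0 < s"
    by (meson dense le_less_trans)
  define B where "B = (1 / s) \<cdot>\<^sub>m (A - m \<cdot>\<^sub>m 1\<^sub>m n)"
  have B: "B \<in> carrier_mat n n"
    unfolding B_def by (intro smult_carrier_mat minus_carrier_mat one_carrier_mat)
  have "A $$ (j, k) = A $$ (k, j)" if "j < n" "k < n" for j k
    using that A sym index_transpose_mat(1)[of k A j] by auto
  then have symB: "B\<^sup>T = B"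
    using A by (intro eq_matI) (auto simp: B_def)
  have "B $$ (i, i) = (A $$ (i, i) - m) / s"
    using A i by (simp add: B_def)
  then have "\<bar>B $$ (i, i)\<bar> > 1"
    using s by (simp add: t_def)
  then have "spectral_radius (map_mat complex_of_real B) \<ge> 1"
    by (rule symmetric_spectral_radius_ge_1[OF B symB i])
  then obtain \<mu> where \<mu>: "eigenvalue (map_mat complex_of_real B) \<mu>" "cmod \<mu> \<ge> 1"
    using spectral_radius_mem_max(1)[of "map_mat complex_of_real B" n] B i
    by (auto simp: spectrum_def)
  have "map_mat complex_of_real B =
      complex_of_real (1 / s) \<cdot>\<^sub>m (?C - complex_of_real m \<cdot>\<^sub>m 1\<^sub>m n)"
    using A by (intro eq_matI) (auto simp: B_def)
  then have "eigenvalue ?C (\<mu> / complex_of_real (1 / s) + complex_of_real m)"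
    using \<mu>(1) s by (intro eigenvalue_affine[OF C]) auto
  \<comment> \<open>The eigenvalue of \<open>?C\<close> obtained from \<open>\<mu>\<close> lies at
    distance \<open>s * cmod \<mu>\<close> from \<open>m\<close>: at most \<open>r\<close> by
    maximality, yet at least \<open>s\<close>.\<close>
  then have "cmod (\<mu> / complex_of_real (1 / s)) \<le> r"
    by (intro r) (force simp: spectrum_def)
  moreover have "s * 1 \<le> cmod (\<mu> / complex_of_real (1 / s))"
    using s \<mu>(2) by (simp add: norm_mult mult.commute)
  ultimately show False
    using s by simp
qed

section \<open>Deviations of the eigenvalues from their mean\<close>

lemma sum_mset_diff_const:
  fixes f :: "'a \<Rightarrow> 'b :: ring_1"
  shows "(\<Sum>x\<in>#M. f x - c) = (\<Sum>x\<in>#M. f x) - of_nat (size M) * c"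
  by (induction M) (simp_all add: algebra_simps)

text \<open>The term \<open>f x\<close> is minus the sum of the others, so by the triangle
  inequality their norms already add up to at least \<open>norm (f x)\<close>.\<close>

lemma sum_mset_norm_ge_twice:
  fixes f :: "'a \<Rightarrow> 'b :: real_normed_vector"
  assumes "x \<in># M" and "(\<Sum>y\<in>#M. f y) = 0"
  shows "2 * norm (f x) \<le> (\<Sum>y\<in>#M. norm (f y))"
proof -
  obtain N where M: "M = add_mset x N"
    using assms(1) by (metis insert_DiffM)
  have "norm (\<Sum>y\<in>#N. f y) \<le> (\<Sum>y\<in>#N. norm (f y))"
    by (induction N) (auto intro: order_trans[OF norm_triangle_ineq])
  moreover have "f x = - (\<Sum>y\<in>#N. f y)"
    using assms(2) by (simp add: M add_eq_0_iff2)
  ultimately show ?thesis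
    by (simp add: M)
qed

lemma symmetric_eigenvalue_deviation_ge:
  fixes A :: "real mat"
  assumes A: "A \<in> carrier_mat n n" and sym: "A\<^sup>T = A" and i: "i < n"
  shows "2 * (A $$ (i, i) - mat_trace A / real n) \<le>
    (\<Sum>\<nu>\<in>#eigenvalues_mset A. cmod (\<nu> - complex_of_real (mat_trace A / real n)))"
proof -
  let ?C = "map_mat complex_of_real A"
  define m where "m = mat_trace A / real n"
  have C: "?C \<in> carrier_mat n n" using A by simp
  note ev = proots_char_poly_complex[OF C, folded eigenvalues_mset_def]
  have "mat_trace ?C = complex_of_real (mat_trace A)"
    using A C by (simp add: mat_trace_eq_sum[of _ n])
  \<comment> \<open>There are \<open>n\<close> eigenvalues and their sum is the trace; the index
    \<open>i\<close> guarantees \<open>n > 0\<close>, so \<open>m\<close> is their mean.\<close>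
  then have "(\<Sum>\<nu>\<in>#eigenvalues_mset A. \<nu> - complex_of_real m) = 0"
    using ev(1,2) i by (simp add: sum_mset_diff_const m_def)
  moreover obtain \<nu> where "\<nu> \<in># eigenvalues_mset A"
    and "\<bar>A $$ (i, i) - m\<bar> \<le> cmod (\<nu> - complex_of_real m)"
    using symmetric_eigenvalue_dist_ge[OF A sym i] ev(3) by blast
  ultimately show ?thesis
    using sum_mset_norm_ge_twice[of \<nu> "eigenvalues_mset A" "\<lambda>\<nu>. \<nu> - complex_of_real m"]
    by (simp add: m_def)
qed

section \<open>Common neighbourhoods\<close>

lemma nbhd_commute: "u \<in> nbhd E v \<longleftrightarrow> v \<in> nbhd E u"
  by (simp add: nbhd_def insert_commute)

context simple_graph
begin

lemma nbhd_subset: "nbhd E v \<subseteq> V"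
  using edges by (auto simp: nbhd_def)

lemma finite_nbhd: "finite (nbhd E v)"
  using nbhd_subset finite_vertices finite_subset by blast

text \<open>Handshake argument: incident vertex-edge pairs are counted first by vertex, then by
  edge.\<close>

lemma sum_vdegree: "(\<Sum>v\<in>V. vdegree E v) = 2 * card E"
proof -
  have fin: "finite E"
    by (rule finite_subset[of _ "Pow V"]) (use edges finite_vertices in auto)
  have "vdegree E v = card {e \<in> E. v \<in> e}" for v
  proof -
    have "{e \<in> E. v \<in> e} = (\<lambda>u. {u, v}) ` nbhd E v"
    proof (intro equalityI subsetI)
      fix e assume e: "e \<in> {e \<in> E. v \<in> e}"
      then obtain a b where "e = {a, b}"
        using edges[of e] by (auto simp: card_2_iff)
      with e have "e = {a, v} \<or> e = {b, v}" by auto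
      with e show "e \<in> (\<lambda>u. {u, v}) ` nbhd E v"
        by (auto simp: nbhd_def)
    qed (auto simp: nbhd_def)
    moreover have "inj_on (\<lambda>u. {u, v}) (nbhd E v)"
      by (auto simp: inj_on_def doubleton_eq_iff)
    ultimately show ?thesis
      by (simp add: vdegree_def card_image)
  qed
  then have "(\<Sum>v\<in>V. vdegree E v) = (\<Sum>v\<in>V. card {e \<in> E. v \<in> e})" by simp
  also have "\<dots> = (\<Sum>e\<in>E. card {v \<in> V. v \<in> e})"
    using sum.swap_restrict[OF finite_vertices fin, of "\<lambda>_ _. 1 :: nat" "\<lambda>v e. v \<in> e"]
    by simp
  also have "\<dots> = (\<Sum>e\<in>E. 2)"
  proof (rule sum.cong[OF refl])
    fix e assume "e \<in> E"
    then have "{v \<in> V. v \<in> e} = e" "card e = 2" using edges by auto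
    then show "card {v \<in> V. v \<in> e} = 2" by simp
  qed
  finally show ?thesis by simp
qed

text \<open>Double counting of the pairs \<open>(w, u)\<close> such that \<open>v, u, w\<close> is a path of length two.\<close>

lemma sum_common_nbhd:
  assumes v: "v \<in> V"
  shows "(\<Sum>w\<in>V - {v}. real (card (nbhd E v \<inter> nbhd E w)))
    = (\<Sum>u\<in>nbhd E v. real (vdegree E u) - 1)"
proof -
  have "(\<Sum>w\<in>V - {v}. card (nbhd E v \<inter> nbhd E w))
      = (\<Sum>w\<in>V - {v}. card {u \<in> nbhd E v. u \<in> nbhd E w})"
    by (simp add: Int_def)
  also have "\<dots> = (\<Sum>u\<in>nbhd E v. card {w \<in> V - {v}. u \<in> nbhd E w})"
    using sum.swap_restrict[of "V - {v}" "nbhd E v" "\<lambda>_ _. 1 :: nat" "\<lambda>w u. u \<in> nbhd E w"]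
      finite_vertices finite_nbhd by simp
  finally have "(\<Sum>w\<in>V - {v}. real (card (nbhd E v \<inter> nbhd E w)))
      = (\<Sum>u\<in>nbhd E v. real (card {w \<in> V - {v}. u \<in> nbhd E w}))"
    by (simp flip: of_nat_sum)
  also have "\<dots> = (\<Sum>u\<in>nbhd E v. real (vdegree E u) - 1)"
  proof (rule sum.cong[OF refl])
    fix u assume u: "u \<in> nbhd E v"
    have "{w \<in> V - {v}. u \<in> nbhd E w} = nbhd E u - {v}"
      using nbhd_subset nbhd_commute[of u E] by auto
    \<comment> \<open>The excluded vertex \<open>v\<close> is itself a neighbour of
      \<open>u\<close>; this is the source of the \<open>- 1\<close>.\<close>
    moreover have "v \<in> nbhd E u"
      using u by (simp add: nbhd_commute)
    ultimately show "real (card {w \<in> V - {v}. u \<in> nbhd E w}) = real (vdegree E u) - 1"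
      using finite_nbhd[of u] by (metis card_Suc_Diff1 add_diff_cancel_left' of_nat_Suc vdegree_def)
  qed
  finally show ?thesis .
qed

text \<open>After swapping the sums, each \<open>u\<close> contributes \<open>d(u) - 1\<close> once
  per neighbour, hence \<open>d(u)^2 - d(u)\<close>; the handshake identity sums the linear
  part.\<close>

lemma sum_sum_nbhd_degree:
  "(\<Sum>v\<in>V. \<Sum>u\<in>nbhd E v. real (vdegree E u) - 1) = real (zagreb1 V E) - 2 * real (card E)"
proof -
  have "(\<Sum>v\<in>V. \<Sum>u\<in>nbhd E v. real (vdegree E u) - 1)
      = (\<Sum>v\<in>V. \<Sum>u\<in>{u \<in> V. u \<in> nbhd E v}. real (vdegree E u) - 1)"
    using nbhd_subset by (intro sum.cong) auto
  also have "\<dots> = (\<Sum>u\<in>V. \<Sum>v\<in>{v \<in> V. u \<in> nbhd E v}. real (vdegree E u) - 1)"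
    by (rule sum.swap_restrict[OF finite_vertices finite_vertices])
  also have "\<dots> = (\<Sum>u\<in>V. \<Sum>v\<in>nbhd E u. real (vdegree E u) - 1)"
    using nbhd_subset nbhd_commute by (intro sum.cong) fastforce+
  also have "\<dots> = (\<Sum>u\<in>V. (real (vdegree E u))\<^sup>2 - real (vdegree E u))"
    by (simp add: vdegree_def power2_eq_square algebra_simps)
  also have "\<dots> = real (zagreb1 V E) - real (\<Sum>u\<in>V. vdegree E u)"
    by (simp add: zagreb1_def sum_subtractf)
  finally show ?thesis
    by (simp add: sum_vdegree)
qed

section \<open>Diagonal and trace of \<open>CNRS\<close>\<close>

context
  fixes vs :: "'a list"
  assumes vs: "distinct vs" "set vs = V"
begin

lemma bij_betw_vs: "bij_betw ((!) vs) {..<length vs} V"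
  by (rule bij_betw_nth) (use vs in auto)

lemma CNRS_diag:
  assumes i: "i < length vs"
  shows "CNRS E vs $$ (i, i) = (\<Sum>u\<in>nbhd E (vs ! i). real (vdegree E u) - 1)"
proof -
  let ?f = "\<lambda>w. real (card (nbhd E (vs ! i) \<inter> nbhd E w))"
  \<comment> \<open>Distinctness of \<open>vs\<close> turns the test on indices into one on
    vertices, so the sum can be reindexed over \<open>V\<close>.\<close>
  have "CNRS E vs $$ (i, i) = (\<Sum>k<length vs. if vs ! k = vs ! i then 0 else ?f (vs ! k))"
    using i vs(1) by (auto simp: CNRS_def CN_def nth_eq_iff_index_eq intro!: sum.cong)
  also have "\<dots> = (\<Sum>w\<in>V. if w = vs ! i then 0 else ?f w)"
    by (rule sum.reindex_bij_betw[OF bij_betw_vs])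
  also have "\<dots> = (\<Sum>w\<in>V - {vs ! i}. ?f w)"
    using finite_vertices by (intro sum.mono_neutral_cong_right) auto
  also have "\<dots> = (\<Sum>u\<in>nbhd E (vs ! i). real (vdegree E u) - 1)"
    using i vs(2) by (intro sum_common_nbhd) auto
  finally show ?thesis .
qed

lemma mat_trace_CNRS: "mat_trace (CNRS E vs) = real (zagreb1 V E) - 2 * real (card E)"
proof -
  have "mat_trace (CNRS E vs) = (\<Sum>i<length vs. CNRS E vs $$ (i, i))"
    by (rule mat_trace_eq_sum) (simp add: CNRS_def)
  also have "\<dots> = (\<Sum>i<length vs. \<Sum>u\<in>nbhd E (vs ! i). real (vdegree E u) - 1)"
    by (simp add: CNRS_diag)
  also have "\<dots> = (\<Sum>v\<in>V. \<Sum>u\<in>nbhd E v. real (vdegree E u) - 1)"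
    by (rule sum.reindex_bij_betw[OF bij_betw_vs])
  finally show ?thesis
    by (simp add: sum_sum_nbhd_degree)
qed

lemma ex_CNRS_diag_ge:
  assumes "V \<noteq> {}"
  shows "\<exists>i<length vs. real (max_degree V E) * (real (min_degree V E) - 1) \<le> CNRS E vs $$ (i, i)"
proof -
  have "max_degree V E \<in> vdegree E ` V"
    using assms finite_vertices by (simp add: max_degree_def)
  then obtain i where i: "i < length vs" and max: "vdegree E (vs ! i) = max_degree V E"
    using vs(2) by (auto simp: in_set_conv_nth)
  \<comment> \<open>The maximum degree is the number of summands at the chosen vertex. Subtraction
    is in the reals, so minimum degree 0 gives summands \<open>-1\<close>, not 0.\<close>
  have "real (max_degree V E) * (real (min_degree V E) - 1)
      = (\<Sum>u\<in>nbhd E (vs ! i). real (min_degree V E) - 1)"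
    by (simp add: max[symmetric] vdegree_def)
  also have "\<dots> \<le> (\<Sum>u\<in>nbhd E (vs ! i). real (vdegree E u) - 1)"
  proof (rule sum_mono)
    fix u assume "u \<in> nbhd E (vs ! i)"
    then have "vdegree E u \<in> vdegree E ` V"
      using nbhd_subset by blast
    then show "real (min_degree V E) - 1 \<le> real (vdegree E u) - 1"
      using finite_vertices by (simp add: min_degree_def)
  qed
  also have "\<dots> = CNRS E vs $$ (i, i)"
    using i by (simp add: CNRS_diag)
  finally show ?thesis
    using i by blast
qed

end

end

section \<open>Transfer to \<open>CNL\<close> and \<open>CNSL\<close>\<close>

lemma CNL_symmetric:
  "CNL E vs \<in> carrier_mat (length vs) (length vs)" "(CNL E vs)\<^sup>T = CNL E vs"
  by (auto simp: CNL_def CNRS_def CN_def Int_commute)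

lemma CNSL_symmetric:
  "CNSL E vs \<in> carrier_mat (length vs) (length vs)" "(CNSL E vs)\<^sup>T = CNSL E vs"
  by (auto simp: CNSL_def CNRS_def CN_def Int_commute)

text \<open>\<open>CN\<close> vanishes on the diagonal, so its sign does not matter there; hence
  both energies receive the same bound.\<close>

lemma CNL_CNSL_diag:
  assumes "i < length vs"
  shows "CNL E vs $$ (i, i) = CNRS E vs $$ (i, i)" "CNSL E vs $$ (i, i) = CNRS E vs $$ (i, i)"
  using assms by (auto simp: CNL_def CNSL_def CNRS_def CN_def)

lemma mat_trace_CNL_CNSL:
  "mat_trace (CNL E vs) = mat_trace (CNRS E vs)" "mat_trace (CNSL E vs) = mat_trace (CNRS E vs)"
proof -
  have "CNRS E vs \<in> carrier_mat (length vs) (length vs)"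
    by (simp add: CNRS_def)
  then show "mat_trace (CNL E vs) = mat_trace (CNRS E vs)"
      "mat_trace (CNSL E vs) = mat_trace (CNRS E vs)"
    by (simp_all add: mat_trace_eq_sum[of _ "length vs"] CNL_symmetric CNSL_symmetric CNL_CNSL_diag)
qed

theorem theorem5p4:
  fixes V :: "'a set" and E :: "'a set set" and vs :: "'a list"
  assumes "simple_graph V E" and "V \<noteq> {}"
    and "distinct vs" and "set vs = V"
  shows "LE_CN E vs \<ge> 2 * (real (max_degree V E) * (real (min_degree V E) - 1)
           - (real (zagreb1 V E) - 2 * real (card E)) / real (card V))
       \<and> LE_CN_plus E vs \<ge> 2 * (real (max_degree V E) * (real (min_degree V E) - 1)
           - (real (zagreb1 V E) - 2 * real (card E)) / real (card V))"
proof -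
  interpret simple_graph V E by fact
  obtain i where i: "i < length vs"
    and ge: "real (max_degree V E) * (real (min_degree V E) - 1) \<le> CNRS E vs $$ (i, i)"
    using ex_CNRS_diag_ge[OF assms(3,4,2)] by blast
  have "card V = length vs"
    using assms(3,4) distinct_card[of vs] by simp
  then have mean: "(real (zagreb1 V E) - 2 * real (card E)) / real (card V)
      = mat_trace (CNRS E vs) / real (length vs)"
    using mat_trace_CNRS[OF assms(3,4)] by simp
  \<comment> \<open>The deviation bound is applied to both matrices at the same index
    \<open>i\<close>, where they share the diagonal entry estimated in \<open>ge\<close>.\<close>
  show ?thesis
    using symmetric_eigenvalue_deviation_ge[OF CNL_symmetric(1,2) i, of E]
      symmetric_eigenvalue_deviation_ge[OF CNSL_symmetric(1,2) i, of E] ge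
    unfolding mean LE_CN_def LE_CN_plus_def
    by (simp add: CNL_CNSL_diag[OF i] mat_trace_CNL_CNSL)
qed

end
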